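(* Let $1\le r\le N$ and let $\mathcal{V}_r(N)=\{X\in\mathbb{R}^{N\times r}:X^\top X=I_r\}$ be the Stiefel manifold. Let $\kappa>0$ be a $C^{(1,1)}$ kernel on $\mathcal{V}_r(N)$ and let $p_\theta(X)\propto\exp(\theta^\top\zeta(X)+\eta(X))$, $\theta\in\mathbb{R}^s$, with $\zeta=(\zeta_1,\dots,\zeta_s)^\top\in C^1(\mathcal{V}_r(N),\mathbb{R}^s)$ and $\eta\in C^1(\mathcal{V}_r(N),\mathbb{R})$. Let $Q(X,Y)\in\mathbb{R}^{s\times s}$ and $b(X,Y)\in\mathbb{R}^s$ be given by $$Q(X,Y)_{kl}=\langle\mathscr{A}(\nabla^{\mathbb{R}}_X\zeta_kX^\top),\mathscr{A}(\nabla^{\mathbb{R}}_Y\zeta_lY^\top)\rangle_F\,\kappa(X,Y),$$ $$b(X,Y)_k=\langle\mathscr{A}(\nabla^{\mathbb{R}}_X\log(e^\eta\kappa)X^\top),\mathscr{A}(\nabla^{\mathbb{R}}_Y\zeta_kY^\top)\rangle_F\,\kappa(X,Y).$$ Let $n\ge2$, $x_1,\dots,x_n\in\mathcal{V}_r(N)$, let $q^w:\mathcal{V}_r(N)\to[0,\infty)$ be a weight function, and set $$Q_u=\sum_{i\ne j}\frac{Q(x_i,x_j)}{n(n-1)}q^w(x_i)q^w(x_j),\quad b_u=\sum_{i\ne j}\frac{b(x_i,x_j)}{n(n-1)}q^w(x_i)q^w(x_j),$$ $$Q_v=\sum_{i,j}\frac{Q(x_i,x_j)}{n^2}q^w(x_i)q^w(x_j),\quad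 b_v=\sum_{i,j}\frac{b(x_i,x_j)}{n^2}q^w(x_i)q^w(x_j).$$ Then the minimum kernel Stein discrepancy estimators can be computed by the following formulas: if $Q_u$ is positive semi-definite, the sets of global minimizers of $U^w_n$ and $V^w_n$ over $\theta\in\mathbb{R}^s$ are $$\operatorname{argmin}U^w_n(\theta)=\{-Q_u^+b_u-(I-Q_u^+Q_u)x:x\in\mathbb{R}^s\},$$ $$\operatorname{argmin}V^w_n(\theta)=\{-Q_v^+b_v-(I-Q_v^+Q_v)x:x\in\mathbb{R}^s\},$$ where $^+$ denotes the Moore–Penrose inverse.
   Context: $\langle A,B\rangle_F=\mathrm{tr}(A^\top B)$, and $\mathscr{A}(A)=(A-A^\top)/2$ for square $A$. $E_{ij}$ is the $N\times N$ matrix with a $1$ in entry $(i,j)$ and zeros elsewhere, $\mathcal{E}_{ij}=\frac{\sqrt2}{2}(E_{ij}-E_{ji})$ for $i<j$, and $K^{ij}$ is the killing field $K^{ij}_X=\mathcal{E}_{ij}X$ on $\mathcal{V}_r(N)$ (from the action $O.X=OX$ of $O(N)$). For bivariate functions, $K^{ij}_X$, $K^{ij}_Y$ act on the first and second argument. A kernel is real-valued, symmetric, positive semi-definite; $C^{(1,1)}$ means once continuously differentiable in each argument with continuous mixed derivative of order $(1,1)$. For a density $p>0$, $$\kappa_p(X,Y)=\kappa(X,Y)\sum_{i<j}\left[K^{ij}_X\log(p(X)\kappa(X,Y))\cdot K^{ij}_Y\log(p(Y)\kappa(X,Y))+K^{ij}_YK^{ij}_X\log\kappa(X,Y)\right],$$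 and the (weighted) empirical kernel Stein discrepancies are $$U^w_n(\theta)=\frac{1}{n(n-1)}\sum_{i\ne j}\kappa_{p_\theta}(x_i,x_j)q^w(x_i)q^w(x_j),\qquad V^w_n(\theta)=\frac1{n^2}\sum_{i,j}\kappa_{p_\theta}(x_i,x_j)q^w(x_i)q^w(x_j);$$ the minimum kernel Stein discrepancy estimator (MKSDE) is a global minimizer of $U^w_n$ or $V^w_n$. The unweighted case is $q^w\equiv1$. For $f$ on a submanifold $M\subset\mathbb{R}^{N\times r}$, a Euclidean gradient $\nabla^{\mathbb{R}}_Xf$ is any matrix in $\mathbb{R}^{N\times r}$ with $D_Xf=\langle\nabla^{\mathbb{R}}_Xf,D_X\rangle_F$ for all $D_X\in T_XM$ (any choice may be used). $\nabla^{\mathbb{R}}_X\log(e^\eta\kappa)$ is the gradient of $X\mapsto\eta(X)+\log\kappa(X,Y)$ with $Y$ fixed.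
   Formalization: The formula for argmin U_n^w is proved only when U_n^w is bounded below over θ; without this it fails, since Q_u may be positive semi-definite with b_u outside its range, so that U_n^w has no minimizer. The V_n^w formula needs no such condition. *)

theory Defs
  imports "HOL-Analysis.Analysis"
begin

section \<open>Matrices\<close>

definition frob_inner :: "real^'c^'m \<Rightarrow> real^'c^'m \<Rightarrow> real" where
  "frob_inner A B = trace (transpose A ** B)"

definition skew_part :: "real^'m^'m \<Rightarrow> real^'m^'m" where
  "skew_part A = (1/2) *\<^sub>R (A - transpose A)"

definition pos_semidef :: "real^'m^'m \<Rightarrow> bool" where
  "pos_semidef A \<longleftrightarrow> transpose A = A \<and> (\<forall>v. 0 \<le> v \<bullet> (A *v v))"

definition is_moore_penrose :: "real^'c^'m \<Rightarrow> real^'m^'c \<Rightarrow> bool" where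
  "is_moore_penrose A P \<longleftrightarrow>
     A ** P ** A = A \<and> P ** A ** P = P \<and>
     transpose (A ** P) = A ** P \<and> transpose (P ** A) = P ** A"

definition mp_inverse :: "real^'c^'m \<Rightarrow> real^'m^'c" where
  "mp_inverse A = (THE P. is_moore_penrose A P)"

type_synonym ('c, 'm) rmat = "((real, 'c) vec, 'm) vec"  \<comment> \<open>\<open>real^'c^'m\<close> without sort constraints\<close>

section \<open>Calculus on a submanifold of a Euclidean space\<close>

definition stiefel :: "(real^'r^'N) set" where
  "stiefel = {X. transpose X ** X = mat 1}"

text \<open>Regularity on an embedded submanifold \<open>M\<close> is expressed by local extensions
  to open subsets of the ambient space.\<close>

definition C1_on :: "'a::real_normed_vector set \<Rightarrow> ('a \<Rightarrow> 'b::real_normed_vector) \<Rightarrow> bool" where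
  "C1_on M f \<longleftrightarrow> (\<forall>X\<in>M. \<exists>U F F'. open U \<and> X \<in> U \<and>
     (\<forall>Z\<in>U. (F has_derivative blinfun_apply (F' Z)) (at Z)) \<and>
     continuous_on U F' \<and> (\<forall>Z\<in>U \<inter> M. F Z = f Z))"

text \<open>The class \<open>C\<^sup>(\<^sup>1\<^sup>,\<^sup>1\<^sup>)\<close>: \<open>D1\<close> and \<open>D2\<close> are the partial derivatives in the first and the
  second argument, and \<open>D12\<close> is the derivative of \<open>D1\<close> in the second argument.\<close>

definition C11_on :: "'a::real_normed_vector set \<Rightarrow> ('a \<Rightarrow> 'a \<Rightarrow> real) \<Rightarrow> bool" where
  "C11_on M k \<longleftrightarrow> (\<forall>X\<in>M. \<forall>Y\<in>M. \<exists>U W F D1 D2 D12.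
     open U \<and> X \<in> U \<and> open W \<and> Y \<in> W \<and>
     (\<forall>x\<in>U. \<forall>y\<in>W.
        ((\<lambda>x'. F x' y) has_derivative blinfun_apply (D1 x y)) (at x) \<and>
        ((\<lambda>y'. F x y') has_derivative blinfun_apply (D2 x y)) (at y) \<and>
        ((\<lambda>y'. D1 x y') has_derivative blinfun_apply (D12 x y)) (at y)) \<and>
     continuous_on (U \<times> W) (\<lambda>(x, y). D1 x y) \<and>
     continuous_on (U \<times> W) (\<lambda>(x, y). D2 x y) \<and>
     continuous_on (U \<times> W) (\<lambda>(x, y). D12 x y) \<and>
     (\<forall>x\<in>U \<inter> M. \<forall>y\<in>W \<inter> M. F x y = k x y))"

definition curve_at :: "'a::real_normed_vector set \<Rightarrow> 'a \<Rightarrow> 'a \<Rightarrow> (real \<Rightarrow> 'a) \<Rightarrow> bool" where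
  "curve_at M X v \<gamma> \<longleftrightarrow>
     \<gamma> 0 = X \<and> (\<forall>t. \<gamma> t \<in> M) \<and> (\<gamma> has_vector_derivative v) (at 0)"

definition tangent_space :: "'a::real_normed_vector set \<Rightarrow> 'a \<Rightarrow> 'a set" where
  "tangent_space M X = {v. \<exists>\<gamma>. curve_at M X v \<gamma>}"

text \<open>The derivative of \<open>f\<close>, a function on \<open>M\<close>, along a tangent vector \<open>v\<close> at \<open>X\<close>:
  the common derivative at \<open>0\<close> of \<open>f\<close> along all curves in \<open>M\<close> with velocity \<open>v\<close> at \<open>X\<close>.
  It does not depend on the values of \<open>f\<close> outside \<open>M\<close>.\<close>

definition tangent_deriv :: "'a::real_normed_vector set \<Rightarrow> ('a \<Rightarrow> real) \<Rightarrow> 'a \<Rightarrow> 'a \<Rightarrow> real" where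
  "tangent_deriv M f X v =
     (THE d. \<forall>\<gamma>. curve_at M X v \<gamma> \<longrightarrow> ((f \<circ> \<gamma>) has_real_derivative d) (at 0))"

definition is_euclidean_gradient ::
    "(real^'r^'N) set \<Rightarrow> (real^'r^'N \<Rightarrow> real) \<Rightarrow> real^'r^'N \<Rightarrow> real^'r^'N \<Rightarrow> bool" where
  "is_euclidean_gradient M f X G \<longleftrightarrow>
     (\<forall>v\<in>tangent_space M X. tangent_deriv M f X v = frob_inner G v)"

section \<open>Killing fields and the kernel Stein discrepancy on the Stiefel manifold\<close>

definition mat_unit :: "'N \<Rightarrow> 'N \<Rightarrow> real^'N^'N" where
  "mat_unit i j = (\<chi> a b. if a = i \<and> b = j then 1 else 0)"

definition skew_unit :: "'N \<Rightarrow> 'N \<Rightarrow> real^'N^'N" where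
  "skew_unit i j = (sqrt 2 / 2) *\<^sub>R (mat_unit i j - mat_unit j i)"

definition killing :: "'N \<Rightarrow> 'N \<Rightarrow> (real^'r^'N \<Rightarrow> real) \<Rightarrow> real^'r^'N \<Rightarrow> real" where
  "killing i j f X = tangent_deriv stiefel f X (skew_unit i j ** X)"

definition is_kernel :: "'a set \<Rightarrow> ('a \<Rightarrow> 'a \<Rightarrow> real) \<Rightarrow> bool" where
  "is_kernel M k \<longleftrightarrow> (\<forall>X\<in>M. \<forall>Y\<in>M. k X Y = k Y X) \<and>
     (\<forall>(m::nat) (x::nat \<Rightarrow> 'a) (c::nat \<Rightarrow> real). (\<forall>i<m. x i \<in> M) \<longrightarrow>
        0 \<le> (\<Sum>i<m. \<Sum>j<m. c i * c j * k (x i) (x j)))"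

definition stein_kernel ::
    "(('r::finite, 'N::{finite,linorder}) rmat \<Rightarrow> real) \<Rightarrow> (('r, 'N) rmat \<Rightarrow> ('r, 'N) rmat \<Rightarrow> real) \<Rightarrow>
     ('r, 'N) rmat \<Rightarrow> ('r, 'N) rmat \<Rightarrow> real" where
  "stein_kernel p \<kappa> X Y = \<kappa> X Y * (\<Sum>(i, j)\<in>{(i, j). i < j}.
       killing i j (\<lambda>X'. ln (p X' * \<kappa> X' Y)) X * killing i j (\<lambda>Y'. ln (p Y' * \<kappa> X Y')) Y
     + killing i j (\<lambda>Y'. killing i j (\<lambda>X'. ln (\<kappa> X' Y')) X) Y)"

text \<open>Weighted averages over all pairs of distinct sample indices, respectively all pairs of
  sample indices; the type of the summands is \<open>real\<close>, a vector type or a matrix type.\<close>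

definition u_average ::
    "nat \<Rightarrow> (nat \<Rightarrow> 'a) \<Rightarrow> ('a \<Rightarrow> real) \<Rightarrow> ('a \<Rightarrow> 'a \<Rightarrow> 'b::real_vector) \<Rightarrow> 'b" where
  "u_average n x q H = (\<Sum>i\<in>{1..n}. \<Sum>j\<in>{1..n} - {i}.
     (q (x i) * q (x j) / (real n * (real n - 1))) *\<^sub>R H (x i) (x j))"

definition v_average ::
    "nat \<Rightarrow> (nat \<Rightarrow> 'a) \<Rightarrow> ('a \<Rightarrow> real) \<Rightarrow> ('a \<Rightarrow> 'a \<Rightarrow> 'b::real_vector) \<Rightarrow> 'b" where
  "v_average n x q H = (\<Sum>i\<in>{1..n}. \<Sum>j\<in>{1..n}.
     (q (x i) * q (x j) / (real n)\<^sup>2) *\<^sub>R H (x i) (x j))"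

definition ksd_u ::
    "nat \<Rightarrow> (nat \<Rightarrow> ('r::finite, 'N::{finite,linorder}) rmat) \<Rightarrow> (('r, 'N) rmat \<Rightarrow> real) \<Rightarrow>
     (real^'s \<Rightarrow> ('r, 'N) rmat \<Rightarrow> real) \<Rightarrow> (('r, 'N) rmat \<Rightarrow> ('r, 'N) rmat \<Rightarrow> real) \<Rightarrow> real^'s \<Rightarrow> real" where
  "ksd_u n x q p \<kappa> \<theta> = u_average n x q (stein_kernel (p \<theta>) \<kappa>)"

definition ksd_v ::
    "nat \<Rightarrow> (nat \<Rightarrow> ('r::finite, 'N::{finite,linorder}) rmat) \<Rightarrow> (('r, 'N) rmat \<Rightarrow> real) \<Rightarrow>
     (real^'s \<Rightarrow> ('r, 'N) rmat \<Rightarrow> real) \<Rightarrow> (('r, 'N) rmat \<Rightarrow> ('r, 'N) rmat \<Rightarrow> real) \<Rightarrow> real^'s \<Rightarrow> real" where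
  "ksd_v n x q p \<kappa> \<theta> = v_average n x q (stein_kernel (p \<theta>) \<kappa>)"

definition argmin_set :: "('a \<Rightarrow> real) \<Rightarrow> 'a set" where
  "argmin_set f = {\<theta>. is_arg_min f (\<lambda>_. True) \<theta>}"

text \<open>Below, \<open>G k X\<close> is a Euclidean gradient of \<open>\<zeta>\<^sub>k\<close> at \<open>X\<close>, and \<open>H X Y\<close> is a Euclidean
  gradient at \<open>X\<close> of \<open>X \<mapsto> log (e\<^sup>\<eta> \<kappa>)\<close> with \<open>Y\<close> fixed.\<close>

definition Q_mat ::
    "('s \<Rightarrow> real^'r^'N \<Rightarrow> real^'r^'N) \<Rightarrow> (real^'r^'N \<Rightarrow> real^'r^'N \<Rightarrow> real) \<Rightarrow>
     real^'r^'N \<Rightarrow> real^'r^'N \<Rightarrow> real^'s^'s" where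
  "Q_mat G \<kappa> X Y = (\<chi> k l.
     frob_inner (skew_part (G k X ** transpose X)) (skew_part (G l Y ** transpose Y)) * \<kappa> X Y)"

definition b_vec ::
    "('s \<Rightarrow> real^'r^'N \<Rightarrow> real^'r^'N) \<Rightarrow> (real^'r^'N \<Rightarrow> real^'r^'N \<Rightarrow> real^'r^'N) \<Rightarrow>
     (real^'r^'N \<Rightarrow> real^'r^'N \<Rightarrow> real) \<Rightarrow> real^'r^'N \<Rightarrow> real^'r^'N \<Rightarrow> real^'s" where
  "b_vec G H \<kappa> X Y = (\<chi> k.
     frob_inner (skew_part (H X Y ** transpose X)) (skew_part (G k Y ** transpose Y)) * \<kappa> X Y)"

end

theory Submission
  imports Defs
begin

text \<open>The matrices \<open>\<E>\<^sub>i\<^sub>j\<close> form an orthonormal basis of the skew-symmetric matrices, so the sum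
  over the Killing fields turns the discrepancy into \<open>\<theta>\<^sup>T Q \<theta> + 2 b\<^sup>T \<theta> + c\<close>; the mixed second derivatives
  only enter \<open>c\<close>.  Such a function is minimised exactly where \<open>Q \<theta> = - b\<close>, provided that \<open>b\<close> is
  orthogonal to the kernel of \<open>Q\<close>.  For the V-statistic this is automatic: if \<open>Q v = 0\<close>, then the
  functions \<open>\<Sum>\<^sub>j c\<^sub>j \<kappa>(\<cdot>, x\<^sub>j)\<close>, where \<open>c\<^sub>j\<close> runs through the entries of
  \<open>q(x\<^sub>j) \<Sum>\<^sub>k v\<^sub>k \<A>(\<nabla>\<zeta>\<^sub>k x\<^sub>j\<^sup>T)\<close>, have norm \<open>0\<close> in the reproducing kernel Hilbert space,
  hence vanish together with their derivatives, of which \<open>b \<cdot> v\<close> is a linear combination.\<close>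

section \<open>Moore--Penrose inverse and quadratic minimisation\<close>

text \<open>A linear map has a linear right inverse on its range; the matrix of that map is a
  generalised inverse, from which the Moore-Penrose inverse is built below.\<close>

lemma matrix_pseudo_inverse_exists:
  fixes A :: "real^'c^'m"
  obtains W where "A ** W ** A = A"
proof -
  obtain g where g: "linear g" "\<forall>v\<in>range ((*v) A). A *v g v = v"
    using linear_exists_right_inverse_on[OF matrix_vector_mul_linear[of A] subspace_UNIV] by blast
  have "A ** matrix g ** A = A"
    using g by (simp add: matrix_eq matrix_vector_mul_assoc[symmetric] matrix_works)
  then show thesis by (rule that)
qed

lemma transpose_mult_self_eq_0:
  fixes A :: "real^'c^'m"
  assumes "transpose A ** A = 0"
  shows "A = 0"
proof -
  have "norm (A *v v) = 0" for v
  proof -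
    have "(A *v v) \<bullet> (A *v v) = v \<bullet> ((transpose A ** A) *v v)"
      by (metis dot_lmul_matrix matrix_vector_mul_assoc vector_transpose_matrix inner_commute)
    then show ?thesis using assms by simp
  qed
  then show ?thesis by (simp add: matrix_eq)
qed

lemma matrix_diff_ldistrib: "A ** (B - D) = A ** B - A ** (D :: real^'c^'m)"
  by (simp add: matrix_matrix_mult_def vec_eq_iff right_diff_distrib sum_subtractf)

text \<open>With \<open>E = A ** (B - D)\<close> the hypothesis gives
  \<open>transpose E ** E = 0\<close>, hence \<open>E = 0\<close>: a real matrix and its Gram matrix
  have the same kernel.\<close>

lemma transpose_mult_left_cancel:
  fixes A :: "real^'c^'m"
  assumes "transpose A ** A ** B = transpose A ** A ** D"
  shows "A ** B = A ** D"
proof -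
  have "transpose A ** A ** (B - D) = 0"
    using assms by (simp add: matrix_diff_ldistrib)
  then have "transpose (A ** (B - D)) ** (A ** (B - D)) = 0"
    by (metis matrix_transpose_mul matrix_mul_assoc times0_right)
  then have "A ** (B - D) = 0" by (rule transpose_mult_self_eq_0)
  then show ?thesis by (simp add: matrix_diff_ldistrib)
qed

lemma transpose_mult_right_cancel:
  fixes A :: "real^'c^'m"
  assumes "B ** A ** transpose A = D ** A ** transpose A"
  shows "B ** A = D ** A"
proof -
  have "transpose (B ** A ** transpose A) = transpose (D ** A ** transpose A)"
    using assms by simp
  then have "transpose (transpose A) ** transpose A ** transpose B
      = transpose (transpose A) ** transpose A ** transpose D"
    by (simp add: matrix_transpose_mul matrix_mul_assoc)
  from transpose_mult_left_cancel[OF this] show ?thesis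
    by (metis matrix_transpose_mul transpose_transpose)
qed

text \<open>For any generalised inverse \<open>W\<close> of \<open>C\<close>, the product
  \<open>transpose A ** W ** transpose A\<close> works: by cancellation, \<open>C ** W\<close> and
  \<open>W ** C\<close> act as identities next to \<open>transpose A\<close>.\<close>

lemma moore_penrose_exists:
  fixes A :: "real^'c^'m"
  obtains P where "is_moore_penrose A P"
proof -
  let ?T = "transpose A"
  define C where "C = ?T ** A ** ?T"
  obtain W where W: "C ** W ** C = C"
    using matrix_pseudo_inverse_exists by blast
  define P where "P = ?T ** W ** ?T"
  \<comment> \<open>Cancelling \<open>?T\<close> and then \<open>A\<close> on the right of
    \<open>C ** W ** C = C\<close> leaves \<open>C ** W ** ?T = ?T\<close>; the mirror image on the
    left follows.\<close>
  have "(C ** W ** ?T) ** A ** ?T = mat 1 ** ?T ** A ** ?T"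
    using W by (simp add: C_def matrix_mul_assoc)
  from transpose_mult_right_cancel[OF this]
  have "(C ** W) ** ?T ** transpose ?T = mat 1 ** ?T ** transpose ?T"
    by simp
  from transpose_mult_right_cancel[OF this] have right: "C ** W ** ?T = ?T" by simp
  have "?T ** A ** (?T ** W ** C) = ?T ** A ** ?T"
    using W by (simp add: C_def matrix_mul_assoc)
  from transpose_mult_left_cancel[OF this]
  have "transpose ?T ** ?T ** (W ** C) = transpose ?T ** ?T ** mat 1"
    by (simp add: matrix_mul_assoc)
  from transpose_mult_left_cancel[OF this] have left: "?T ** W ** C = ?T"
    by (simp add: matrix_mul_assoc)
  have tap: "?T ** (A ** P) = ?T"
    using right by (simp add: P_def C_def matrix_mul_assoc)
  have pat: "P ** A ** ?T = ?T"
    using left by (simp add: P_def C_def matrix_mul_assoc)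
  \<comment> \<open>An identity \<open>transpose M = transpose M ** M\<close> makes \<open>M\<close>
    symmetric, because its right-hand side is.\<close>
  have sym1: "transpose (A ** P) = A ** P"
  proof -
    have "transpose (A ** P) = transpose (A ** P) ** (A ** P)"
      using tap by (metis matrix_transpose_mul matrix_mul_assoc)
    then show ?thesis by (metis matrix_transpose_mul transpose_transpose)
  qed
  have sym2: "transpose (P ** A) = P ** A"
  proof -
    have "transpose (P ** A) = (P ** A) ** transpose (P ** A)"
      using pat by (metis matrix_transpose_mul matrix_mul_assoc)
    then show ?thesis by (metis matrix_transpose_mul transpose_transpose)
  qed
  have apa: "A ** P ** A = A"
    using tap sym1 by (metis matrix_transpose_mul transpose_transpose)
  have "P ** A ** P = ?T ** W ** (C ** W ** ?T)"
    by (simp add: P_def C_def matrix_mul_assoc)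
  also have "\<dots> = P" by (simp add: right P_def)
  finally have "is_moore_penrose A P"
    using apa sym1 sym2 by (simp add: is_moore_penrose_def)
  then show thesis by (rule that)
qed

text \<open>\<open>A ** P\<close> and \<open>A ** R\<close> are both the orthogonal projection onto
  the column space of \<open>A\<close>, \<open>P ** A\<close> and \<open>R ** A\<close> the one onto
  its row space. Then P = PAP = RAP = RAR = R.\<close>

lemma moore_penrose_unique:
  fixes A :: "real^'c^'m"
  assumes "is_moore_penrose A P" "is_moore_penrose A R"
  shows "P = R"
proof -
  have p: "A ** P ** A = A" "P ** A ** P = P" "transpose (A ** P) = A ** P" "transpose (P ** A) = P ** A"
    and r: "A ** R ** A = A" "R ** A ** R = R" "transpose (A ** R) = A ** R" "transpose (R ** A) = R ** A"
    using assms by (auto simp: is_moore_penrose_def)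
  have 1: "A ** P = A ** R"
  proof -
    have "A ** P = transpose ((A ** R) ** (A ** P))"
      using p(3) r(1) by (simp add: matrix_mul_assoc)
    also have "\<dots> = (A ** P) ** (A ** R)" by (simp only: matrix_transpose_mul[of "A ** R" "A ** P"] p r)
    also have "\<dots> = A ** R" using p(1) by (simp add: matrix_mul_assoc)
    finally show ?thesis .
  qed
  have 2: "P ** A = R ** A"
  proof -
    have "P ** A = transpose ((P ** A) ** (R ** A))"
      using p(4) r(1) by (metis matrix_mul_assoc)
    also have "\<dots> = (R ** A) ** (P ** A)" by (simp only: matrix_transpose_mul[of "P ** A" "R ** A"] p r)
    also have "\<dots> = R ** A" using p(1) by (metis matrix_mul_assoc)
    finally show ?thesis .
  qed
  show ?thesis using 1 2 p(2) r(2) by (metis matrix_mul_assoc)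
qed

lemma mp_inverse_is_moore_penrose: "is_moore_penrose A (mp_inverse A)"
proof -
  obtain P where P: "is_moore_penrose A P" by (rule moore_penrose_exists)
  then show ?thesis
    unfolding mp_inverse_def by (rule theI) (rule moore_penrose_unique[OF _ P])
qed

section \<open>Singular linear systems and minimisers of quadratic functions\<close>

lemma inner_matrix_vector_transpose:
  fixes A :: "real^'c^'m"
  shows "(A *v u) \<bullet> v = u \<bullet> (transpose A *v v)"
  by (metis dot_lmul_matrix inner_commute vector_transpose_matrix transpose_transpose)

text \<open>By symmetry \<open>A A\<^sup>+\<close> is the orthogonal projection along the kernel of \<open>A\<close>.\<close>
lemma mp_inverse_solves:
  fixes A :: "real^'s^'s"
  assumes sym: "transpose A = A" and ker: "\<And>v. A *v v = 0 \<Longrightarrow> b \<bullet> v = 0"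
  shows "A *v (mp_inverse A *v b) = b"
proof -
  let ?P = "mp_inverse A"
  have mp: "A ** ?P ** A = A" "transpose (A ** ?P) = A ** ?P"
    using mp_inverse_is_moore_penrose[of A] by (auto simp: is_moore_penrose_def)
  \<comment> \<open>The residual of the projection. In v.v = b.v - (APb).v the first term vanishes
    since \<open>v\<close> lies in the kernel of \<open>A\<close>, the second since AP is symmetric
    and annihilates \<open>v\<close>.\<close>
  define v where "v = b - (A ** ?P) *v b"
  have "A ** (A ** ?P) = A"
    using mp sym by (metis matrix_transpose_mul)
  then have Av: "A *v v = 0"
    by (simp add: v_def matrix_vector_mult_diff_distrib matrix_vector_mul_assoc)
  have "(A ** ?P) *v v = 0"
    using mp(1) by (simp add: v_def matrix_vector_mult_diff_distrib matrix_vector_mul_assoc matrix_mul_assoc)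
  then have "((A ** ?P) *v b) \<bullet> v = 0"
    by (simp add: inner_matrix_vector_transpose mp(2))
  then have "v \<bullet> v = 0"
    using ker[OF Av] by (simp add: v_def inner_diff_left)
  then show ?thesis by (simp add: v_def matrix_vector_mul_assoc)
qed

text \<open>The polynomial attains its minimum 0 at \<open>t = 0\<close>, where its derivative is
  \<open>2 * s\<close>. This serves both the first-order condition below and the Cauchy-Schwarz
  argument for kernels.\<close>

lemma quadratic_nonneg_imp_linear_coeff_0:
  fixes a s :: real
  assumes "\<And>t. 0 \<le> a * t\<^sup>2 + 2 * s * t"
  shows "s = 0"
proof -
  have "((\<lambda>t. a * t\<^sup>2 + 2 * s * t) has_real_derivative 2 * s) (at 0)"
    by (auto intro!: derivative_eq_intros)
  then have "2 * s = 0"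
    by (rule DERIV_local_min[of _ _ _ 1]) (use assms in auto)
  then show ?thesis by simp
qed

text \<open>Expanding \<open>f\<close> around a point shows that the minimisers are the solutions of
  A\<theta> = -b. The formula lists them as one particular solution plus the kernel of
  \<open>A\<close>, which is the range of \<open>mat 1 - mp_inverse A ** A\<close>.\<close>

lemma argmin_quadratic:
  fixes A :: "real^'s^'s"
  assumes psd: "pos_semidef A" and ker: "\<And>v. A *v v = 0 \<Longrightarrow> b \<bullet> v = 0"
    and f: "\<And>\<theta>. f \<theta> = \<theta> \<bullet> (A *v \<theta>) + 2 * (b \<bullet> \<theta>) + c"
  shows "argmin_set f = {- (mp_inverse A *v b) - (mat 1 - mp_inverse A ** A) *v y | y. True}"
proof -
  let ?P = "mp_inverse A"
  have sym: "transpose A = A" and nonneg: "\<And>v. 0 \<le> v \<bullet> (A *v v)"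
    using psd by (auto simp: pos_semidef_def)
  have mp: "A ** ?P ** A = A"
    using mp_inverse_is_moore_penrose[of A] by (auto simp: is_moore_penrose_def)
  have solves: "A *v (?P *v b) = b"
    by (rule mp_inverse_solves[OF sym ker])
  have shift: "f (\<theta> + v) = f \<theta> + 2 * ((A *v \<theta> + b) \<bullet> v) + v \<bullet> (A *v v)" for \<theta> v
  proof -
    have "\<theta> \<bullet> (A *v v) = (A *v \<theta>) \<bullet> v"
      by (simp add: inner_matrix_vector_transpose sym)
    then show ?thesis
      by (simp add: f matrix_vector_right_distrib inner_add_left inner_add_right inner_commute algebra_simps)
  qed
  have "is_arg_min f (\<lambda>_. True) \<theta> \<longleftrightarrow> A *v \<theta> = - b" for \<theta>
  proof
    assume "A *v \<theta> = - b"
    then have "f \<theta> \<le> f \<theta>'" for \<theta>'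
      using shift[of \<theta> "\<theta>' - \<theta>"] nonneg[of "\<theta>' - \<theta>"] by simp
    then show "is_arg_min f (\<lambda>_. True) \<theta>" by (simp add: is_arg_min_def not_less)
  next
    assume min: "is_arg_min f (\<lambda>_. True) \<theta>"
    \<comment> \<open>Half the gradient at \<theta>; moving in this direction itself makes the
      linear coefficient \<open>2 * (g \<bullet> g)\<close>.\<close>
    define g where "g = A *v \<theta> + b"
    have "0 \<le> 2 * (t * (g \<bullet> g)) + t\<^sup>2 * (g \<bullet> (A *v g))" for t
    proof -
      have "f \<theta> \<le> f (\<theta> + t *\<^sub>R g)" using min by (simp add: is_arg_min_def not_less)
      then show ?thesis
        by (simp add: shift g_def[symmetric] matrix_vector_mult_scaleR power2_eq_square)
    qed
    then have "0 \<le> (g \<bullet> (A *v g)) * t\<^sup>2 + 2 * (g \<bullet> g) * t" for t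
      by (simp add: algebra_simps)
    then have "g \<bullet> g = 0" by (rule quadratic_nonneg_imp_linear_coeff_0)
    then show "A *v \<theta> = - b" by (simp add: g_def eq_neg_iff_add_eq_0)
  qed
  moreover have "A *v \<theta> = - b \<longleftrightarrow> (\<exists>y. \<theta> = - (?P *v b) - (mat 1 - ?P ** A) *v y)" for \<theta>
  proof
    assume "A *v \<theta> = - b"
    then have "?P *v (A *v \<theta>) = - (?P *v b)"
      by (simp add: linear_neg[OF matrix_vector_mul_linear])
    then have "\<theta> = - (?P *v b) - (mat 1 - ?P ** A) *v (- \<theta>)"
      by (simp add: matrix_vector_mult_diff_rdistrib matrix_vector_mul_assoc linear_neg[OF matrix_vector_mul_linear])
    then show "\<exists>y. \<theta> = - (?P *v b) - (mat 1 - ?P ** A) *v y" by blast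
  next
    assume "\<exists>y. \<theta> = - (?P *v b) - (mat 1 - ?P ** A) *v y"
    then obtain y where y: "\<theta> = - (?P *v b) - (mat 1 - ?P ** A) *v y" by blast
    have "A *v ((?P ** A) *v y) = A *v y"
      using mp by (simp add: matrix_vector_mul_assoc matrix_mul_assoc)
    then show "A *v \<theta> = - b"
      using solves
      by (simp add: y matrix_vector_mult_diff_rdistrib matrix_vector_mult_diff_distrib linear_neg[OF matrix_vector_mul_linear])
  qed
  ultimately show ?thesis by (simp add: argmin_set_def)
qed

text \<open>On the line spanned by a kernel vector \<open>v\<close>, \<open>f\<close> is affine with
  slope \<open>2 * (b \<bullet> v)\<close>.\<close>

lemma bdd_below_quadratic_orthogonal_kernel:
  fixes A :: "real^'s^'s"
  assumes bdd: "bdd_below (range f)" and f: "\<And>\<theta>. f \<theta> = \<theta> \<bullet> (A *v \<theta>) + 2 * (b \<bullet> \<theta>) + c"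
    and v: "A *v v = 0"
  shows "b \<bullet> v = 0"
proof (rule ccontr)
  assume ne: "b \<bullet> v \<noteq> 0"
  obtain m where m: "\<And>\<theta>. m \<le> f \<theta>" using bdd by (auto simp: bdd_below_def)
  have "m \<le> 2 * (t * (b \<bullet> v)) + c" for t
    using m[of "t *\<^sub>R v"] by (simp add: f matrix_vector_mult_scaleR v)
  \<comment> \<open>This \<open>t\<close> is chosen so that \<open>f\<close> takes the value
    \<open>m - 1\<close>, below its lower bound.\<close>
  moreover have "2 * ((m - c - 1) / (2 * (b \<bullet> v)) * (b \<bullet> v)) = m - c - 1" using ne by simp
  ultimately have "m \<le> m - c - 1 + c" by metis
  then show False by simp
qed

section \<open>Skew-symmetric matrices\<close>

lemma frob_inner_eq_inner: "frob_inner A B = A \<bullet> B"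
  unfolding frob_inner_def trace_def transpose_def matrix_matrix_mult_def inner_vec_def
  by (simp, subst sum.swap, simp)

text \<open>The adjoint of E \<mapsto> EX. It turns a derivative along a Killing field into a
  pairing with a fixed square matrix, the source of the products with \<open>transpose X\<close> in
  \<open>Q_mat\<close> and \<open>b_vec\<close>.\<close>

lemma inner_matrix_mult_right:
  fixes G :: "real^'r^'N"
  shows "G \<bullet> (E ** X) = (G ** transpose X) \<bullet> E"
proof -
  have "G \<bullet> (E ** X) = (\<Sum>i\<in>UNIV. \<Sum>r\<in>UNIV. \<Sum>k\<in>UNIV. G $ i $ r * X $ k $ r * E $ i $ k)"
    by (simp add: inner_vec_def matrix_matrix_mult_def sum_distrib_left mult_ac)
  also have "\<dots> = (\<Sum>i\<in>UNIV. \<Sum>k\<in>UNIV. \<Sum>r\<in>UNIV. G $ i $ r * X $ k $ r * E $ i $ k)"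
    by (rule sum.cong[OF refl]) (rule sum.swap)
  also have "\<dots> = (G ** transpose X) \<bullet> E"
    by (simp add: inner_vec_def matrix_matrix_mult_def transpose_def sum_distrib_right)
  finally show ?thesis .
qed

lemma inner_mat_unit: "M \<bullet> mat_unit i j = M $ i $ j"
proof -
  have "M \<bullet> mat_unit i j = (\<Sum>a\<in>UNIV. if a = i then \<Sum>b\<in>UNIV. if b = j then M $ a $ b else 0 else 0)"
    unfolding inner_vec_def mat_unit_def
    by (intro sum.cong refl) (auto simp: if_distrib cong: if_cong intro!: sum.cong)
  then show ?thesis by simp
qed

lemma skew_part_nth: "skew_part M $ i $ j = (M $ i $ j - M $ j $ i) / 2"
  by (simp add: skew_part_def transpose_def)

lemma inner_skew_unit: "M \<bullet> skew_unit i j = sqrt 2 * skew_part M $ i $ j"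
  by (simp add: skew_unit_def inner_diff_right inner_mat_unit skew_part_nth)

text \<open>Parseval's identity. The product of entries is symmetric in the two indices and zero on
  the diagonal, so the full sum is twice the sum over \<open>i < j\<close>; this 2 is the square of
  the factor in \<open>inner_skew_unit\<close>.\<close>

lemma sum_inner_skew_unit:
  fixes M M' :: "('N::{finite,linorder}, 'N) rmat"
  shows "(\<Sum>(i, j)\<in>{(i, j). i < j}. (M \<bullet> skew_unit i j) * (M' \<bullet> skew_unit i j))
    = skew_part M \<bullet> skew_part M'"
proof -
  define f where "f = (\<lambda>(i, j). skew_part M $ i $ j * skew_part M' $ i $ j)"
  let ?L = "{(i, j). i < j} :: ('N \<times> 'N) set"
  let ?R = "{(i, j). j < i} :: ('N \<times> 'N) set"
  have sym: "f (i, j) = f (j, i)" for i j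
    by (simp add: f_def skew_part_nth field_simps)
  have diag: "f (i, i) = 0" for i
    by (simp add: f_def skew_part_nth)
  have "skew_part M \<bullet> skew_part M' = sum f (UNIV \<times> UNIV)"
    by (simp add: inner_vec_def f_def sum.cartesian_product)
  also have "\<dots> = sum f (?L \<union> ?R)"
  proof (rule sum.mono_neutral_right)
    show "\<forall>z\<in>UNIV \<times> UNIV - (?L \<union> ?R). f z = 0"
    proof
      fix z assume z: "z \<in> UNIV \<times> UNIV - (?L \<union> ?R)"
      obtain a b where ab: "z = (a, b)" by (cases z)
      then have "a = b" using z linorder_less_linear[of a b] by auto
      then show "f z = 0" using ab diag by simp
    qed
  qed auto
  also have "\<dots> = sum f ?L + sum f ?R"
    by (rule sum.union_disjoint) auto
  also have "sum f ?R = sum f ?L"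
    by (rule sum.reindex_bij_witness[of _ prod.swap prod.swap]) (auto simp: sym)
  also have "sum f ?L + sum f ?L
      = (\<Sum>(i, j)\<in>?L. (M \<bullet> skew_unit i j) * (M' \<bullet> skew_unit i j))"
    by (simp add: sum.distrib[symmetric] f_def inner_skew_unit case_prod_unfold mult_ac)
      (simp add: mult.assoc[symmetric])
  finally show ?thesis by simp
qed

section \<open>Derivatives along curves\<close>

lemma mat_unit_mult: "mat_unit a b ** mat_unit c d = (if b = c then mat_unit a d else 0)"
proof -
  have "(\<Sum>k\<in>UNIV. (if i = a \<and> k = b then 1 else 0) * (if k = c \<and> j = d then 1 else (0::real)))
      = (\<Sum>k\<in>UNIV. if k = b then (if i = a \<and> b = c \<and> j = d then 1 else 0) else 0)" for i j
    by (rule sum.cong) auto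
  then show ?thesis
    by (simp add: mat_unit_def matrix_matrix_mult_def vec_eq_iff)
qed

lemma transpose_mat_unit: "transpose (mat_unit i j) = mat_unit j i"
  by (auto simp: mat_unit_def transpose_def vec_eq_iff)

lemma transpose_add: "transpose (A + B :: real^'c^'m) = transpose A + transpose B"
  by (simp add: transpose_def vec_eq_iff)

lemma transpose_diff: "transpose (A - B :: real^'c^'m) = transpose A - transpose B"
  by (simp add: transpose_def vec_eq_iff)

lemma transpose_scaleR: "transpose (c *\<^sub>R A :: real^'c^'m) = c *\<^sub>R transpose A"
  by (simp add: transpose_def vec_eq_iff)

lemma scaleR_mult_left: "(c *\<^sub>R A) ** B = c *\<^sub>R (A ** (B :: real^'c^'m))"
  by (simp add: matrix_matrix_mult_def vec_eq_iff sum_distrib_left mult_ac)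

lemma scaleR_mult_right: "A ** (c *\<^sub>R B) = c *\<^sub>R (A ** (B :: real^'c^'m))"
  by (simp add: matrix_matrix_mult_def vec_eq_iff sum_distrib_left mult_ac)

lemma matrix_add_rdistrib: "(A + B) ** D = A ** D + B ** (D :: real^'c^'m)"
  by (simp add: matrix_matrix_mult_def vec_eq_iff distrib_right sum.distrib)

lemma matrix_diff_rdistrib: "(A - B) ** D = A ** D - B ** (D :: real^'c^'m)"
  by (simp add: matrix_matrix_mult_def vec_eq_iff left_diff_distrib sum_subtractf)

text \<open>For \<open>i \<noteq> j\<close> this is the exponential of \<open>a\<close> times
  \<open>mat_unit i j - mat_unit j i\<close>, in closed form.\<close>

definition plane_rotation :: "'N \<Rightarrow> 'N \<Rightarrow> real \<Rightarrow> real^'N^'N" where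
  "plane_rotation i j a = mat 1 + sin a *\<^sub>R (mat_unit i j - mat_unit j i)
     + (cos a - 1) *\<^sub>R (mat_unit i i + mat_unit j j)"

lemma orthogonal_plane_rotation:
  assumes "i \<noteq> j"
  shows "transpose (plane_rotation i j a) ** plane_rotation i j a = mat 1"
proof -
  define J P where "J = mat_unit i j - mat_unit j i" and "P = mat_unit i i + mat_unit j j"
  define s c where "s = sin a" and "c = cos a - 1"
  have sc: "2 * c + c * c + s * s = 0"
    using sin_cos_squared_add[of a] by (simp add: s_def c_def power2_eq_square algebra_simps)
  have JJ: "J ** J = - P"
    using assms by (simp add: J_def P_def matrix_diff_ldistrib matrix_diff_rdistrib mat_unit_mult)
  have JP: "J ** P = J"
    using assms by (simp add: J_def P_def matrix_add_ldistrib matrix_diff_rdistrib mat_unit_mult)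
  have PJ: "P ** J = J"
    using assms by (simp add: J_def P_def matrix_diff_ldistrib matrix_add_rdistrib mat_unit_mult)
  have PP: "P ** P = P"
    using assms by (simp add: P_def matrix_add_ldistrib matrix_add_rdistrib mat_unit_mult)
  have rot: "plane_rotation i j a = mat 1 + s *\<^sub>R J + c *\<^sub>R P"
    by (simp add: plane_rotation_def J_def P_def s_def c_def)
  have "transpose J = - J" "transpose P = P"
    by (simp_all add: J_def P_def transpose_add transpose_diff transpose_mat_unit add.commute)
  moreover have "transpose (plane_rotation i j a)
      = mat 1 + s *\<^sub>R transpose J + c *\<^sub>R transpose P"
    by (simp add: rot transpose_add transpose_scaleR)
  ultimately have "transpose (plane_rotation i j a) ** plane_rotation i j a
      = (mat 1 - s *\<^sub>R J + c *\<^sub>R P) ** (mat 1 + s *\<^sub>R J + c *\<^sub>R P)"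
    by (simp add: rot)
  also have "\<dots> = mat 1 + (2 * c + c * c + s * s) *\<^sub>R P"
    by (simp add: matrix_add_ldistrib matrix_add_rdistrib matrix_diff_rdistrib
        scaleR_mult_left scaleR_mult_right JJ JP PJ PP)
      (simp add: vec_eq_iff algebra_simps)
  finally show ?thesis by (simp add: sc)
qed

text \<open>Shows that the Killing vectors are tangent, so that \<open>tangent_deriv\<close> is
  determined along them. The case \<open>i = j\<close> is included because arbitrary entries of a
  skew part are read off later.\<close>

lemma stiefel_rotation_curve:
  assumes "X \<in> stiefel"
  obtains \<gamma> where "curve_at stiefel X (skew_unit i j ** X) \<gamma>"
proof (cases "i = j")
  case True
  then have "skew_unit i j = 0" by (simp add: skew_unit_def)
  then have "curve_at stiefel X (skew_unit i j ** X) (\<lambda>_. X)"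
    using assms by (simp add: curve_at_def)
  then show thesis by (rule that)
next
  case False
  let ?J = "mat_unit i j - mat_unit j i" and ?P = "mat_unit i i + mat_unit j j"
  \<comment> \<open>The angular speed is the normalising factor of \<open>skew_unit\<close>.\<close>
  define \<gamma> where "\<gamma> t = plane_rotation i j (sqrt 2 / 2 * t) ** X" for t
  have "transpose (\<gamma> t) ** \<gamma> t
      = transpose X ** (transpose (plane_rotation i j (sqrt 2 / 2 * t))
          ** plane_rotation i j (sqrt 2 / 2 * t)) ** X" for t
    by (simp add: \<gamma>_def matrix_transpose_mul matrix_mul_assoc)
  then have "\<gamma> t \<in> stiefel" for t
    using assms by (simp add: orthogonal_plane_rotation[OF False] stiefel_def)
  moreover have \<gamma>: "\<gamma> = (\<lambda>t. X + sin (sqrt 2 / 2 * t) *\<^sub>R (?J ** X) + (cos (sqrt 2 / 2 * t) - 1) *\<^sub>R (?P ** X))"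
    by (simp add: fun_eq_iff \<gamma>_def plane_rotation_def matrix_add_rdistrib scaleR_mult_left)
  moreover have "(\<gamma> has_vector_derivative skew_unit i j ** X) (at 0)"
    unfolding \<gamma> skew_unit_def scaleR_mult_left
    by (rule derivative_eq_intros refl | simp)+
  ultimately have "curve_at stiefel X (skew_unit i j ** X) \<gamma>"
    by (simp add: curve_at_def)
  then show thesis by (rule that)
qed

text \<open>Here differentiability along every curve is asserted, whereas the description operator
  in \<open>tangent_deriv\<close> leaves it open.\<close>

definition derivative_along_curves ::
  "'a::real_normed_vector set \<Rightarrow> ('a \<Rightarrow> 'b::real_normed_vector) \<Rightarrow> 'a \<Rightarrow> ('a \<Rightarrow> 'b) \<Rightarrow> bool" where
  "derivative_along_curves M f X L \<longleftrightarrow>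
     (\<forall>v \<gamma>. curve_at M X v \<gamma> \<longrightarrow> ((\<lambda>t. f (\<gamma> t)) has_vector_derivative L v) (at 0))"

lemma derivative_along_curves_extension:
  assumes U: "open U" "X \<in> U" and F: "(F has_derivative F') (at X)"
    and eq: "\<And>Z. Z \<in> U \<inter> M \<Longrightarrow> F Z = f Z"
  shows "derivative_along_curves M f X F'"
  unfolding derivative_along_curves_def
proof (intro allI impI)
  fix v \<gamma> assume "curve_at M X v \<gamma>"
  then have 0: "\<gamma> 0 = X" and M: "\<And>t. \<gamma> t \<in> M" and \<gamma>: "(\<gamma> has_vector_derivative v) (at 0)"
    by (auto simp: curve_at_def)
  have "((F \<circ> \<gamma>) has_derivative (F' \<circ> (\<lambda>h. h *\<^sub>R v))) (at 0)"
    using \<gamma> F 0 by (intro diff_chain_at) (simp_all add: has_vector_derivative_def)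
  moreover have "F' \<circ> (\<lambda>h. h *\<^sub>R v) = (\<lambda>h. h *\<^sub>R F' v)"
    using linear_cmul[OF has_derivative_linear[OF F]] by auto
  ultimately have d: "((\<lambda>t. F (\<gamma> t)) has_derivative (\<lambda>h. h *\<^sub>R F' v)) (at 0)"
    by (simp add: o_def)
  \<comment> \<open>Continuity keeps the curve inside \<open>U\<close> near 0, where the extension
    agrees with \<open>f\<close> on the manifold.\<close>
  have "(\<gamma> \<longlongrightarrow> \<gamma> 0) (at 0)"
    using has_vector_derivative_continuous[OF \<gamma>] by (simp add: isCont_def)
  then have "\<forall>\<^sub>F t in at 0. \<gamma> t \<in> U"
    by (rule topological_tendstoD) (use U 0 in auto)
  then have "\<forall>\<^sub>F t in at 0. F (\<gamma> t) = f (\<gamma> t)"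
    by eventually_elim (use eq M in auto)
  then show "((\<lambda>t. f (\<gamma> t)) has_vector_derivative F' v) (at 0)"
    unfolding has_vector_derivative_def
    by (rule has_derivative_transform_eventually[OF d]) (use eq M 0 U in auto)
qed

lemma C1_on_derivative_along_curves:
  assumes "C1_on M f" "X \<in> M"
  obtains L where "derivative_along_curves M f X L"
proof -
  obtain U F F' where *: "open U \<and> X \<in> U \<and>
     (\<forall>Z\<in>U. (F has_derivative blinfun_apply (F' Z)) (at Z)) \<and>
     continuous_on U F' \<and> (\<forall>Z\<in>U \<inter> M. F Z = f Z)"
    using bspec[OF assms(1)[unfolded C1_on_def] assms(2)] by (elim exE)
  then have U: "open U" "X \<in> U" and D: "(F has_derivative blinfun_apply (F' X)) (at X)"
    and eq: "\<forall>Z\<in>U \<inter> M. F Z = f Z"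
    by blast+
  have "derivative_along_curves M f X (blinfun_apply (F' X))"
    using eq by (intro derivative_along_curves_extension[OF U D]) blast
  then show thesis by (rule that)
qed

lemma C11_on_derivative_along_curves:
  assumes "C11_on M k" "X \<in> M" "Y \<in> M"
  obtains L where "derivative_along_curves M (\<lambda>X'. k X' Y) X L"
proof -
  obtain U W F D1 D2 D12 where *: "open U \<and> X \<in> U \<and> open W \<and> Y \<in> W \<and>
     (\<forall>x\<in>U. \<forall>y\<in>W.
        ((\<lambda>x'. F x' y) has_derivative blinfun_apply (D1 x y)) (at x) \<and>
        ((\<lambda>y'. F x y') has_derivative blinfun_apply (D2 x y)) (at y) \<and>
        ((\<lambda>y'. D1 x y') has_derivative blinfun_apply (D12 x y)) (at y)) \<and>
     continuous_on (U \<times> W) (\<lambda>(x, y). D1 x y) \<and>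
     continuous_on (U \<times> W) (\<lambda>(x, y). D2 x y) \<and>
     continuous_on (U \<times> W) (\<lambda>(x, y). D12 x y) \<and>
     (\<forall>x\<in>U \<inter> M. \<forall>y\<in>W \<inter> M. F x y = k x y)"
    using bspec[OF bspec[OF assms(1)[unfolded C11_on_def] assms(2)] assms(3)] by (elim exE)
  then have U: "open U" "X \<in> U" and W: "Y \<in> W"
    and D: "((\<lambda>x'. F x' Y) has_derivative blinfun_apply (D1 X Y)) (at X)"
    and eq: "\<forall>x\<in>U \<inter> M. \<forall>y\<in>W \<inter> M. F x y = k x y"
    by blast+
  have "derivative_along_curves M (\<lambda>X'. k X' Y) X (blinfun_apply (D1 X Y))"
    using eq W assms(3) by (intro derivative_along_curves_extension[OF U D]) blast
  then show thesis by (rule that)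
qed

text \<open>The curve \<open>\<gamma>\<^sub>0\<close> gives uniqueness: without any curve every
  number would meet the description.\<close>

lemma tangent_deriv_eqI:
  assumes "\<And>\<gamma>. curve_at M X v \<gamma> \<Longrightarrow> ((\<lambda>t. f (\<gamma> t)) has_real_derivative d) (at 0)"
    and "curve_at M X v \<gamma>\<^sub>0"
  shows "tangent_deriv M f X v = d"
  unfolding tangent_deriv_def
proof (rule the_equality)
  show "\<forall>\<gamma>. curve_at M X v \<gamma> \<longrightarrow> ((f \<circ> \<gamma>) has_real_derivative d) (at 0)"
    using assms(1) by (simp add: o_def)
next
  fix d' assume "\<forall>\<gamma>. curve_at M X v \<gamma> \<longrightarrow> ((f \<circ> \<gamma>) has_real_derivative d') (at 0)"
  then have "((\<lambda>t. f (\<gamma>\<^sub>0 t)) has_real_derivative d') (at 0)"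
    using assms(2) by (simp add: o_def)
  then show "d' = d" by (rule DERIV_unique) (rule assms(1)[OF assms(2)])
qed

text \<open>Allows kernel symmetry and the form of the density, known only on the manifold, to be
  used under a derivative.\<close>

lemma tangent_deriv_cong:
  assumes "\<And>Z. Z \<in> M \<Longrightarrow> f Z = g Z"
  shows "tangent_deriv M f X v = tangent_deriv M g X v"
proof -
  have "curve_at M X v \<gamma> \<Longrightarrow> f \<circ> \<gamma> = g \<circ> \<gamma>" for \<gamma>
    using assms by (auto simp: curve_at_def)
  then show ?thesis
    unfolding tangent_deriv_def by (intro arg_cong[where f = The] ext all_cong1 imp_cong refl) simp
qed

text \<open>The gradient condition alone only evaluates a description operator; combined with
  differentiability along curves it yields an actual derivative.\<close>

lemma euclidean_gradient_along_curve:
  assumes "is_euclidean_gradient M f X D" "derivative_along_curves M f X L" "curve_at M X v \<gamma>"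
  shows "((\<lambda>t. f (\<gamma> t)) has_real_derivative D \<bullet> v) (at 0)"
proof -
  have L: "((\<lambda>t. f (\<gamma>' t)) has_real_derivative L v) (at 0)" if "curve_at M X v \<gamma>'" for \<gamma>'
    using assms(2) that
    by (simp add: derivative_along_curves_def has_real_derivative_iff_has_vector_derivative)
  then have "tangent_deriv M f X v = L v"
    using assms(3) by (rule tangent_deriv_eqI)
  moreover have "v \<in> tangent_space M X"
    using assms(3) by (auto simp: tangent_space_def)
  ultimately have "L v = D \<bullet> v"
    using assms(1) by (simp add: is_euclidean_gradient_def frob_inner_eq_inner)
  then show ?thesis using L[OF assms(3)] by simp
qed

section \<open>Positive semi-definite kernels\<close>

lemma kernel_sum_nonneg:
  fixes x :: "nat \<Rightarrow> 'a"
  assumes "is_kernel M k" "\<forall>i\<in>{1..n}. x i \<in> M"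
  shows "0 \<le> (\<Sum>i\<in>{1..n}. \<Sum>j\<in>{1..n}. c i * c j * k (x i) (x j))"
proof -
  have "0 \<le> (\<Sum>i<n. \<Sum>j<n. (c \<circ> Suc) i * (c \<circ> Suc) j * k ((x \<circ> Suc) i) ((x \<circ> Suc) j))"
    by (rule assms(1)[unfolded is_kernel_def, THEN conjunct2, rule_format]) (use assms(2) in auto)
  then show ?thesis by (simp add: sum.atLeast1_atMost_eq)
qed

text \<open>The kernel is applied to the point \<open>Z\<close> with an arbitrary weight together with the sample:
  this is the Cauchy--Schwarz inequality in the associated Hilbert space.\<close>
lemma kernel_null_combination:
  fixes x :: "nat \<Rightarrow> 'a"
  assumes k: "is_kernel M k" and x: "\<forall>i\<in>{1..n}. x i \<in> M" and Z: "Z \<in> M"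
    and null: "(\<Sum>i\<in>{1..n}. \<Sum>j\<in>{1..n}. c i * c j * k (x i) (x j)) = 0"
  shows "(\<Sum>j\<in>{1..n}. c j * k Z (x j)) = 0"
proof -
  \<comment> \<open>This is \<open>x\<close> with the value at index 0, outside the sample range,
    replaced by \<open>Z\<close>; the weight \<open>t\<close> is put there likewise.\<close>
  define x' where "x' = case_nat Z (x \<circ> Suc)"
  have x': "x' i \<in> M" if "i < Suc n" for i
    using that x Z by (cases i) (auto simp: x'_def)
  have null': "(\<Sum>i<n. \<Sum>j<n. c (Suc i) * c (Suc j) * k (x (Suc i)) (x (Suc j))) = 0"
    using null by (simp add: sum.atLeast1_atMost_eq)
  have sym: "k (x (Suc i)) Z = k Z (x (Suc i))" if "i < n" for i
    using k x Z that by (auto simp: is_kernel_def)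
  let ?s = "\<Sum>j<n. c (Suc j) * k Z (x (Suc j))"
  have "0 \<le> k Z Z * t\<^sup>2 + 2 * ?s * t" for t
  proof -
    define c' where "c' = case_nat t (c \<circ> Suc)"
    have "0 \<le> (\<Sum>i<Suc n. \<Sum>j<Suc n. c' i * c' j * k (x' i) (x' j))"
      using k x' unfolding is_kernel_def by blast
    also have "\<dots> = t * t * k Z Z + (\<Sum>j<n. t * c (Suc j) * k Z (x (Suc j)))
        + (\<Sum>i<n. c (Suc i) * t * k (x (Suc i)) Z)"
      using null' by (simp add: sum.lessThan_Suc_shift c'_def x'_def sum.distrib del: sum.lessThan_Suc)
    also have "(\<Sum>i<n. c (Suc i) * t * k (x (Suc i)) Z) = ?s * t"
      by (simp add: sum_distrib_left sym mult_ac)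
    also have "(\<Sum>j<n. t * c (Suc j) * k Z (x (Suc j))) = ?s * t"
      by (simp add: sum_distrib_left mult_ac)
    finally show ?thesis by (simp add: power2_eq_square algebra_simps)
  qed
  then have "?s = 0" by (rule quadratic_nonneg_imp_linear_coeff_0)
  then show ?thesis by (simp add: sum.atLeast1_atMost_eq)
qed

section \<open>The kernel Stein discrepancy as a quadratic function\<close>

text \<open>Treats both statistics at once: they differ only in the weights \<open>W\<close>, which
  are zero on the diagonal for the U-statistic.\<close>

definition pair_sum ::
    "(nat \<Rightarrow> nat \<Rightarrow> real) \<Rightarrow> nat \<Rightarrow> (nat \<Rightarrow> 'a) \<Rightarrow> ('a \<Rightarrow> 'a \<Rightarrow> 'b::real_vector) \<Rightarrow> 'b" where
  "pair_sum W n x f = (\<Sum>i\<in>{1..n}. \<Sum>j\<in>{1..n}. W i j *\<^sub>R f (x i) (x j))"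

lemma v_average_eq_pair_sum:
  "v_average n x q = pair_sum (\<lambda>i j. q (x i) * q (x j) / (real n)\<^sup>2) n x"
  by (simp add: fun_eq_iff v_average_def pair_sum_def)

lemma u_average_eq_pair_sum:
  "u_average n x q
    = pair_sum (\<lambda>i j. if i = j then 0 else q (x i) * q (x j) / (real n * (real n - 1))) n x"
  unfolding fun_eq_iff u_average_def pair_sum_def
  by (intro allI sum.cong refl sum.mono_neutral_cong_left) auto

lemma pair_sum_add: "pair_sum W n x (\<lambda>X Y. f X Y + g X Y) = pair_sum W n x f + pair_sum W n x g"
  by (simp add: pair_sum_def scaleR_add_right sum.distrib)

lemma pair_sum_linear:
  assumes "linear h"
  shows "pair_sum W n x (\<lambda>X Y. h (f X Y)) = h (pair_sum W n x f)"
  by (simp add: pair_sum_def linear_sum[OF assms] linear_cmul[OF assms])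

lemma pair_sum_swap:
  assumes "\<And>i j. W i j = W j i"
  shows "pair_sum W n x (\<lambda>X Y. f Y X) = pair_sum W n x f"
  unfolding pair_sum_def by (subst sum.swap) (simp add: assms)

lemma pair_sum_cong:
  assumes "\<forall>i\<in>{1..n}. x i \<in> M" "\<And>X Y. X \<in> M \<Longrightarrow> Y \<in> M \<Longrightarrow> f X Y = g X Y"
  shows "pair_sum W n x f = pair_sum W n x g"
  using assms by (simp add: pair_sum_def)

text \<open>If the \<open>G k\<close> are gradients of the components of \<zeta>, this is the skew
  part attached to the scalar function \<open>v \<bullet> \<zeta>\<close>.\<close>

definition skew_combination ::
    "('s \<Rightarrow> real^'r^'N \<Rightarrow> real^'r^'N) \<Rightarrow> real^'s \<Rightarrow> real^'r^'N \<Rightarrow> real^'N^'N" where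
  "skew_combination G v X = (\<Sum>k\<in>UNIV. v $ k *\<^sub>R skew_part (G k X ** transpose X))"

lemma skew_part_add: "skew_part (A + B) = skew_part A + skew_part B"
  by (simp add: skew_part_def vec_eq_iff transpose_def field_simps)

lemma skew_part_scaleR: "skew_part (c *\<^sub>R A) = c *\<^sub>R skew_part A"
  by (simp add: skew_part_def transpose_scaleR scaleR_diff_right)

lemma linear_skew_part_mult: "linear (\<lambda>D. skew_part (D ** B))"
  by (rule linearI) (simp_all add: matrix_add_rdistrib scaleR_mult_left skew_part_add skew_part_scaleR)

lemma skew_combination_eq:
  "skew_combination G v X = skew_part ((\<Sum>k\<in>UNIV. v $ k *\<^sub>R G k X) ** transpose X)"
  by (simp add: skew_combination_def linear_sum[OF linear_skew_part_mult]
      linear_cmul[OF linear_skew_part_mult])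

lemma Q_mat_quadratic_form:
  "u \<bullet> (Q_mat G \<kappa> X Y *v v) = \<kappa> X Y * (skew_combination G u X \<bullet> skew_combination G v Y)"
  unfolding skew_combination_def inner_sum_left unfolding inner_sum_right
  by (simp add: inner_vec_def[of u] matrix_vector_mult_def Q_mat_def frob_inner_eq_inner
      sum_distrib_left mult_ac)

lemma b_vec_inner:
  "b_vec G H \<kappa> X Y \<bullet> v
    = \<kappa> X Y * (skew_part (H X Y ** transpose X) \<bullet> skew_combination G v Y)"
  unfolding skew_combination_def inner_sum_right
  by (simp add: inner_vec_def[of _ v] b_vec_def frob_inner_eq_inner sum_distrib_left mult_ac)

lemma linear_quadratic_form: "linear (\<lambda>A :: real^'c^'m. u \<bullet> (A *v v))"
  by (rule linearI)
    (simp_all only: matrix_vector_mult_add_rdistrib inner_add_right inner_scaleR_right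
      scaleR_matrix_vector_assoc[symmetric] real_scaleR_def)

lemma linear_inner_left: "linear (\<lambda>b. b \<bullet> v)"
  by (rule linearI) (simp_all add: inner_add_left)

section \<open>Symmetry and positive semi-definiteness of the averaged matrices\<close>

lemma transpose_pair_sum_Q_mat:
  assumes "\<And>i j. W i j = W j i" "\<forall>i\<in>{1..n}. x i \<in> M" "is_kernel M \<kappa>"
  shows "transpose (pair_sum W n x (Q_mat G \<kappa>)) = pair_sum W n x (Q_mat G \<kappa>)"
proof -
  have "linear (transpose :: real^'s^'s \<Rightarrow> _)"
    by (rule linearI) (simp_all add: transpose_add transpose_scaleR)
  then have "transpose (pair_sum W n x (Q_mat G \<kappa>)) = pair_sum W n x (\<lambda>X Y. transpose (Q_mat G \<kappa> X Y))"
    by (rule pair_sum_linear[symmetric])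
  \<comment> \<open>Transposing exchanges the two arguments; the symmetric weights undo the
    exchange.\<close>
  also have "\<dots> = pair_sum W n x (\<lambda>X Y. Q_mat G \<kappa> Y X)"
    using assms(2)
  proof (rule pair_sum_cong)
    fix X Y assume "X \<in> M" "Y \<in> M"
    then have "\<kappa> X Y = \<kappa> Y X" using assms(3) by (simp add: is_kernel_def)
    then show "transpose (Q_mat G \<kappa> X Y) = Q_mat G \<kappa> Y X"
      by (simp add: Q_mat_def transpose_def vec_eq_iff frob_inner_eq_inner inner_commute)
  qed
  also have "\<dots> = pair_sum W n x (Q_mat G \<kappa>)"
    using assms(1) by (rule pair_sum_swap)
  finally show ?thesis .
qed

text \<open>The V-weights factor over \<open>i\<close> and \<open>j\<close> and the Frobenius
  product splits over matrix entries, which leaves one nonnegative kernel form per entry.\<close>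

lemma v_average_Q_mat_quadratic_form:
  "v \<bullet> (v_average n x q (Q_mat G \<kappa>) *v v)
    = (\<Sum>\<alpha>\<in>UNIV. \<Sum>\<beta>\<in>UNIV. \<Sum>i\<in>{1..n}. \<Sum>j\<in>{1..n}.
        (q (x i) * skew_combination G v (x i) $ \<alpha> $ \<beta>)
        * (q (x j) * skew_combination G v (x j) $ \<alpha> $ \<beta>) * \<kappa> (x i) (x j)) / (real n)\<^sup>2"
proof -
  let ?a = "skew_combination G v"
  let ?f = "\<lambda>i j \<alpha> \<beta>. (q (x i) * ?a (x i) $ \<alpha> $ \<beta>) * (q (x j) * ?a (x j) $ \<alpha> $ \<beta>) * \<kappa> (x i) (x j)"
  have "v \<bullet> (v_average n x q (Q_mat G \<kappa>) *v v)
      = (\<Sum>i\<in>{1..n}. \<Sum>j\<in>{1..n}. q (x i) * q (x j) / (real n)\<^sup>2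
          * (\<kappa> (x i) (x j) * (?a (x i) \<bullet> ?a (x j))))"
    unfolding v_average_eq_pair_sum pair_sum_linear[OF linear_quadratic_form, symmetric]
    by (simp add: pair_sum_def Q_mat_quadratic_form)
  also have "\<dots> = (\<Sum>i\<in>{1..n}. \<Sum>j\<in>{1..n}. \<Sum>\<alpha>\<in>UNIV. \<Sum>\<beta>\<in>UNIV. ?f i j \<alpha> \<beta>) / (real n)\<^sup>2"
    by (simp add: inner_vec_def sum_distrib_left sum_divide_distrib mult_ac)
  also have "(\<Sum>i\<in>{1..n}. \<Sum>j\<in>{1..n}. \<Sum>\<alpha>\<in>UNIV. \<Sum>\<beta>\<in>UNIV. ?f i j \<alpha> \<beta>)
      = (\<Sum>i\<in>{1..n}. \<Sum>\<alpha>\<in>UNIV. \<Sum>j\<in>{1..n}. \<Sum>\<beta>\<in>UNIV. ?f i j \<alpha> \<beta>)"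
    by (intro sum.cong refl sum.swap)
  also have "\<dots> = (\<Sum>\<alpha>\<in>UNIV. \<Sum>i\<in>{1..n}. \<Sum>j\<in>{1..n}. \<Sum>\<beta>\<in>UNIV. ?f i j \<alpha> \<beta>)"
    by (rule sum.swap)
  also have "\<dots> = (\<Sum>\<alpha>\<in>UNIV. \<Sum>i\<in>{1..n}. \<Sum>\<beta>\<in>UNIV. \<Sum>j\<in>{1..n}. ?f i j \<alpha> \<beta>)"
    by (intro sum.cong refl sum.swap)
  also have "\<dots> = (\<Sum>\<alpha>\<in>UNIV. \<Sum>\<beta>\<in>UNIV. \<Sum>i\<in>{1..n}. \<Sum>j\<in>{1..n}. ?f i j \<alpha> \<beta>)"
    by (intro sum.cong refl sum.swap)
  finally show ?thesis .
qed

lemma pos_semidef_v_average_Q_mat: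
  assumes "is_kernel M \<kappa>" "\<forall>i\<in>{1..n}. x i \<in> M"
  shows "pos_semidef (v_average n x q (Q_mat G \<kappa>))"
  unfolding pos_semidef_def
proof
  show "transpose (v_average n x q (Q_mat G \<kappa>)) = v_average n x q (Q_mat G \<kappa>)"
    unfolding v_average_eq_pair_sum
    by (rule transpose_pair_sum_Q_mat[OF _ assms(2,1)]) (simp add: mult.commute)
  show "\<forall>v. 0 \<le> v \<bullet> (v_average n x q (Q_mat G \<kappa>) *v v)"
    unfolding v_average_Q_mat_quadratic_form
    by (intro allI divide_nonneg_nonneg sum_nonneg kernel_sum_nonneg[OF assms]) simp_all
qed

lemma double_sum_nonneg_eq_0:
  fixes f :: "'a::finite \<Rightarrow> 'b::finite \<Rightarrow> real"
  assumes "\<And>a b. 0 \<le> f a b" "(\<Sum>a\<in>UNIV. \<Sum>b\<in>UNIV. f a b) = 0"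
  shows "f a b = 0"
  using assms by (simp add: sum_nonneg_eq_0_iff sum_nonneg)

text \<open>The normalising constant is only asked to exist for each \<theta>: its logarithm is
  constant on the manifold and drops out of all derivatives.\<close>

locale exponential_family_stein =
  fixes \<kappa> :: "('r::finite, 'N::{finite,linorder}) rmat \<Rightarrow> ('r, 'N) rmat \<Rightarrow> real"
    and \<zeta> :: "('r, 'N) rmat \<Rightarrow> real^'s"
    and \<eta> :: "('r, 'N) rmat \<Rightarrow> real"
    and p :: "real^'s \<Rightarrow> ('r, 'N) rmat \<Rightarrow> real"
    and G :: "'s \<Rightarrow> ('r, 'N) rmat \<Rightarrow> ('r, 'N) rmat"
    and H :: "('r, 'N) rmat \<Rightarrow> ('r, 'N) rmat \<Rightarrow> ('r, 'N) rmat"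
  assumes kernel: "is_kernel stiefel \<kappa>"
    and kernel_pos: "\<forall>X\<in>stiefel. \<forall>Y\<in>stiefel. 0 < \<kappa> X Y"
    and kernel_C11: "C11_on stiefel \<kappa>"
    and \<zeta>_C1: "C1_on stiefel \<zeta>"
    and \<eta>_C1: "C1_on stiefel \<eta>"
    and density: "\<forall>\<theta>. \<exists>c>0. \<forall>X\<in>stiefel. p \<theta> X = c * exp (\<theta> \<bullet> \<zeta> X + \<eta> X)"
    and \<zeta>_gradient: "\<forall>k. \<forall>X\<in>stiefel. is_euclidean_gradient stiefel (\<lambda>X'. \<zeta> X' $ k) X (G k X)"
    and log_gradient: "\<forall>X\<in>stiefel. \<forall>Y\<in>stiefel.
           is_euclidean_gradient stiefel (\<lambda>X'. ln (exp (\<eta> X') * \<kappa> X' Y)) X (H X Y)"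
begin

lemma \<zeta>_along_curve:
  assumes "X \<in> stiefel" "curve_at stiefel X v \<gamma>"
  shows "((\<lambda>t. \<zeta> (\<gamma> t) $ k) has_real_derivative G k X \<bullet> v) (at 0)"
proof -
  obtain L where L: "derivative_along_curves stiefel \<zeta> X L"
    by (rule C1_on_derivative_along_curves[OF \<zeta>_C1 assms(1)])
  have D: "derivative_along_curves stiefel (\<lambda>X'. \<zeta> X' $ k) X (\<lambda>v. L v $ k)"
    unfolding derivative_along_curves_def
    by (intro allI impI bounded_linear.has_vector_derivative[OF bounded_linear_vec_nth])
      (use L in \<open>simp add: derivative_along_curves_def\<close>)
  show ?thesis
    by (rule euclidean_gradient_along_curve[OF _ D assms(2)]) (use \<zeta>_gradient assms(1) in blast)
qed

lemma log_along_curve: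
  assumes X: "X \<in> stiefel" and Y: "Y \<in> stiefel" and "curve_at stiefel X v \<gamma>"
  shows "((\<lambda>t. ln (exp (\<eta> (\<gamma> t)) * \<kappa> (\<gamma> t) Y)) has_real_derivative H X Y \<bullet> v) (at 0)"
proof -
  obtain L1 where L1: "derivative_along_curves stiefel \<eta> X L1"
    by (rule C1_on_derivative_along_curves[OF \<eta>_C1 X])
  obtain L2 where L2: "derivative_along_curves stiefel (\<lambda>X'. \<kappa> X' Y) X L2"
    by (rule C11_on_derivative_along_curves[OF kernel_C11 X Y])
  \<comment> \<open>The quotient establishes differentiability; the gradient hypothesis then
    identifies its value as \<open>H X Y \<bullet> v\<close>.\<close>
  have D: "derivative_along_curves stiefel (\<lambda>X'. ln (exp (\<eta> X') * \<kappa> X' Y)) X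
      (\<lambda>v. (exp (\<eta> X) * L1 v * \<kappa> X Y + exp (\<eta> X) * L2 v) / (exp (\<eta> X) * \<kappa> X Y))"
    unfolding derivative_along_curves_def has_real_derivative_iff_has_vector_derivative[symmetric]
  proof (intro allI impI)
    fix v \<gamma> assume c: "curve_at stiefel X v \<gamma>"
    then have \<gamma>0: "\<gamma> 0 = X" by (simp add: curve_at_def)
    have 1: "((\<lambda>t. \<eta> (\<gamma> t)) has_real_derivative L1 v) (at 0)"
      and 2: "((\<lambda>t. \<kappa> (\<gamma> t) Y) has_real_derivative L2 v) (at 0)"
      using L1 L2 c
      by (simp_all add: derivative_along_curves_def has_real_derivative_iff_has_vector_derivative)
    have "0 < \<kappa> X Y" using kernel_pos X Y by blast
    then show "((\<lambda>t. ln (exp (\<eta> (\<gamma> t)) * \<kappa> (\<gamma> t) Y)) has_real_derivative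
        (exp (\<eta> X) * L1 v * \<kappa> X Y + exp (\<eta> X) * L2 v) / (exp (\<eta> X) * \<kappa> X Y)) (at 0)"
      by (auto intro!: derivative_eq_intros 1 2 simp: \<gamma>0 field_simps)
  qed
  show ?thesis
    by (rule euclidean_gradient_along_curve[OF _ D assms(3)]) (use log_gradient X Y in blast)
qed

text \<open>The logarithm splits into a constant, a part linear in \<theta> and the part with
  gradient \<open>H\<close>, so the result is affine in \<theta>.\<close>

lemma killing_log_density:
  assumes X: "X \<in> stiefel" and Y: "Y \<in> stiefel"
  shows "killing i j (\<lambda>X'. ln (p \<theta> X' * \<kappa> X' Y)) X
    = (((\<Sum>k\<in>UNIV. \<theta> $ k *\<^sub>R G k X) + H X Y) ** transpose X) \<bullet> skew_unit i j"
proof -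
  obtain c where c: "c > 0" "\<And>Z. Z \<in> stiefel \<Longrightarrow> p \<theta> Z = c * exp (\<theta> \<bullet> \<zeta> Z + \<eta> Z)"
    using density by blast
  have ln: "ln (p \<theta> Z * \<kappa> Z Y) = ln c + (\<Sum>k\<in>UNIV. \<theta> $ k * \<zeta> Z $ k) + ln (exp (\<eta> Z) * \<kappa> Z Y)"
    if Z: "Z \<in> stiefel" for Z
  proof -
    have "0 < \<kappa> Z Y" using kernel_pos Z Y by blast
    then show ?thesis using c Z by (simp add: ln_mult inner_vec_def)
  qed
  obtain \<gamma>\<^sub>0 where \<gamma>0: "curve_at stiefel X (skew_unit i j ** X) \<gamma>\<^sub>0"
    by (rule stiefel_rotation_curve[OF X])
  have "killing i j (\<lambda>X'. ln (p \<theta> X' * \<kappa> X' Y)) X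
      = tangent_deriv stiefel (\<lambda>Z. ln c + (\<Sum>k\<in>UNIV. \<theta> $ k * \<zeta> Z $ k) + ln (exp (\<eta> Z) * \<kappa> Z Y))
          X (skew_unit i j ** X)"
    unfolding killing_def by (rule tangent_deriv_cong) (rule ln)
  also have "\<dots> = ((\<Sum>k\<in>UNIV. \<theta> $ k *\<^sub>R G k X) + H X Y) \<bullet> (skew_unit i j ** X)"
  proof (rule tangent_deriv_eqI[OF _ \<gamma>0])
    fix \<gamma> assume \<gamma>: "curve_at stiefel X (skew_unit i j ** X) \<gamma>"
    have "((\<lambda>t. ln c + (\<Sum>k\<in>UNIV. \<theta> $ k * \<zeta> (\<gamma> t) $ k) + ln (exp (\<eta> (\<gamma> t)) * \<kappa> (\<gamma> t) Y))
        has_real_derivative 0 + (\<Sum>k\<in>UNIV. \<theta> $ k * (G k X \<bullet> (skew_unit i j ** X)))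
          + H X Y \<bullet> (skew_unit i j ** X)) (at 0)"
      by (intro DERIV_add DERIV_const DERIV_sum DERIV_cmult \<zeta>_along_curve[OF X \<gamma>]
          log_along_curve[OF X Y \<gamma>])
    then show "((\<lambda>t. ln c + (\<Sum>k\<in>UNIV. \<theta> $ k * \<zeta> (\<gamma> t) $ k) + ln (exp (\<eta> (\<gamma> t)) * \<kappa> (\<gamma> t) Y))
        has_real_derivative ((\<Sum>k\<in>UNIV. \<theta> $ k *\<^sub>R G k X) + H X Y) \<bullet> (skew_unit i j ** X)) (at 0)"
      by (simp add: inner_add_left inner_sum_left)
  qed
  finally show ?thesis by (simp add: inner_matrix_mult_right)
qed

lemma stein_kernel_quadratic:
  obtains C where "\<And>\<theta> X Y. X \<in> stiefel \<Longrightarrow> Y \<in> stiefel \<Longrightarrow>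
    stein_kernel (p \<theta>) \<kappa> X Y
      = \<theta> \<bullet> (Q_mat G \<kappa> X Y *v \<theta>) + b_vec G H \<kappa> X Y \<bullet> \<theta> + b_vec G H \<kappa> Y X \<bullet> \<theta> + C X Y"
proof -
  define mixed where "mixed X Y = (\<Sum>(i, j)\<in>{(i, j). i < j}.
    killing i j (\<lambda>Y'. killing i j (\<lambda>X'. ln (\<kappa> X' Y')) X) Y)" for X Y
  define B where "B X Y = skew_part (H X Y ** transpose X)" for X Y
  have "stein_kernel (p \<theta>) \<kappa> X Y
      = \<theta> \<bullet> (Q_mat G \<kappa> X Y *v \<theta>) + b_vec G H \<kappa> X Y \<bullet> \<theta> + b_vec G H \<kappa> Y X \<bullet> \<theta>
        + \<kappa> X Y * (B X Y \<bullet> B Y X + mixed X Y)"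
    if X: "X \<in> stiefel" and Y: "Y \<in> stiefel" for \<theta> X Y
  proof -
    have sym: "\<kappa> Z W = \<kappa> W Z" if "Z \<in> stiefel" "W \<in> stiefel" for Z W
      using kernel that by (simp add: is_kernel_def)
    let ?T = "\<lambda>X Y. ((\<Sum>k\<in>UNIV. \<theta> $ k *\<^sub>R G k X) + H X Y) ** transpose X"
    have T: "skew_part (?T X Y) = skew_combination G \<theta> X + B X Y" for X Y
      by (simp add: skew_combination_eq B_def matrix_add_rdistrib skew_part_add)
    \<comment> \<open>Symmetry moves the differentiated variable into the first slot, so that
      \<open>H Y X\<close> describes the second factor.\<close>
    have "killing i j (\<lambda>Y'. ln (p \<theta> Y' * \<kappa> X Y')) Y = killing i j (\<lambda>Y'. ln (p \<theta> Y' * \<kappa> Y' X)) Y" for i j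
      unfolding killing_def by (rule tangent_deriv_cong) (simp add: sym[OF X])
    then have "stein_kernel (p \<theta>) \<kappa> X Y
        = \<kappa> X Y * ((\<Sum>(i, j)\<in>{(i, j). i < j}. (?T X Y \<bullet> skew_unit i j) * (?T Y X \<bullet> skew_unit i j)) + mixed X Y)"
      by (simp add: stein_kernel_def mixed_def killing_log_density X Y case_prod_unfold sum.distrib)
    also have "\<dots> = \<kappa> X Y * ((skew_combination G \<theta> X + B X Y) \<bullet> (skew_combination G \<theta> Y + B Y X) + mixed X Y)"
      by (simp only: sum_inner_skew_unit T)
    also have "\<dots> = \<kappa> X Y * (skew_combination G \<theta> X \<bullet> skew_combination G \<theta> Y)
        + \<kappa> X Y * (B X Y \<bullet> skew_combination G \<theta> Y) + \<kappa> Y X * (B Y X \<bullet> skew_combination G \<theta> X)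
        + \<kappa> X Y * (B X Y \<bullet> B Y X + mixed X Y)"
      by (simp add: sym[OF Y X] inner_add_left inner_add_right inner_commute algebra_simps)
    finally show ?thesis
      by (simp add: Q_mat_quadratic_form b_vec_inner B_def)
  qed
  then show thesis by (rule that)
qed

lemma pair_sum_stein_kernel_quadratic:
  assumes W: "\<And>i j. W i j = W j i" and x: "\<forall>i\<in>{1..n}. x i \<in> stiefel"
  obtains c where "\<And>\<theta>. pair_sum W n x (stein_kernel (p \<theta>) \<kappa>)
    = \<theta> \<bullet> (pair_sum W n x (Q_mat G \<kappa>) *v \<theta>) + 2 * (pair_sum W n x (b_vec G H \<kappa>) \<bullet> \<theta>) + c"
proof -
  obtain C where C: "\<And>\<theta> X Y. X \<in> stiefel \<Longrightarrow> Y \<in> stiefel \<Longrightarrow>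
    stein_kernel (p \<theta>) \<kappa> X Y
      = \<theta> \<bullet> (Q_mat G \<kappa> X Y *v \<theta>) + b_vec G H \<kappa> X Y \<bullet> \<theta> + b_vec G H \<kappa> Y X \<bullet> \<theta> + C X Y"
    by (rule stein_kernel_quadratic) blast
  have "pair_sum W n x (stein_kernel (p \<theta>) \<kappa>)
    = \<theta> \<bullet> (pair_sum W n x (Q_mat G \<kappa>) *v \<theta>) + 2 * (pair_sum W n x (b_vec G H \<kappa>) \<bullet> \<theta>)
      + pair_sum W n x C" for \<theta>
  proof -
    have "pair_sum W n x (stein_kernel (p \<theta>) \<kappa>)
        = pair_sum W n x (\<lambda>X Y. \<theta> \<bullet> (Q_mat G \<kappa> X Y *v \<theta>) + b_vec G H \<kappa> X Y \<bullet> \<theta>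
            + b_vec G H \<kappa> Y X \<bullet> \<theta> + C X Y)"
      using x by (rule pair_sum_cong) (rule C)
    also have "\<dots> = pair_sum W n x (\<lambda>X Y. \<theta> \<bullet> (Q_mat G \<kappa> X Y *v \<theta>))
        + pair_sum W n x (\<lambda>X Y. b_vec G H \<kappa> X Y \<bullet> \<theta>)
        + pair_sum W n x (\<lambda>X Y. b_vec G H \<kappa> Y X \<bullet> \<theta>) + pair_sum W n x C"
      by (simp only: pair_sum_add)
    \<comment> \<open>The two linear terms become equal after summation, whence the factor
      2.\<close>
    also have "pair_sum W n x (\<lambda>X Y. b_vec G H \<kappa> Y X \<bullet> \<theta>) = pair_sum W n x (\<lambda>X Y. b_vec G H \<kappa> X Y \<bullet> \<theta>)"
      using W by (rule pair_sum_swap)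
    finally show ?thesis
      by (simp only: pair_sum_linear[OF linear_quadratic_form] pair_sum_linear[OF linear_inner_left])
  qed
  then show thesis by (rule that)
qed

text \<open>If \<open>f = \<Sum>\<^sub>j c\<^sub>j \<kappa>(\<cdot>, x\<^sub>j)\<close> vanishes on the manifold, then so does the derivative of \<open>e\<^sup>\<eta> f\<close>,
  which is \<open>e\<^sup>\<eta> \<Sum>\<^sub>j c\<^sub>j \<kappa>(\<cdot>, x\<^sub>j) D log (e\<^sup>\<eta> \<kappa>(\<cdot>, x\<^sub>j))\<close>.\<close>
lemma null_combination_derivative:
  assumes X: "X \<in> stiefel" and x: "\<forall>j\<in>{1..n}. x j \<in> stiefel"
    and null: "\<And>Z. Z \<in> stiefel \<Longrightarrow> (\<Sum>j\<in>{1..n}. c j * \<kappa> Z (x j)) = 0"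
  shows "(\<Sum>j\<in>{1..n}. c j * \<kappa> X (x j) * (skew_part (H X (x j) ** transpose X) $ \<alpha> $ \<beta>)) = 0"
proof -
  obtain \<gamma> where \<gamma>: "curve_at stiefel X (skew_unit \<alpha> \<beta> ** X) \<gamma>"
    by (rule stiefel_rotation_curve[OF X])
  then have \<gamma>0: "\<gamma> 0 = X" and \<gamma>M: "\<gamma> t \<in> stiefel" for t
    by (auto simp: curve_at_def)
  let ?d = "\<lambda>j. H X (x j) \<bullet> (skew_unit \<alpha> \<beta> ** X)"
  let ?f = "\<lambda>j t. ln (exp (\<eta> (\<gamma> t)) * \<kappa> (\<gamma> t) (x j))"
  \<comment> \<open>Exponentiating the logarithm lets \<open>log_along_curve\<close> supply the
    derivative in terms of \<open>H\<close>.\<close>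
  have exp: "exp (?f j t) = exp (\<eta> (\<gamma> t)) * \<kappa> (\<gamma> t) (x j)" if "j \<in> {1..n}" for j t
    using kernel_pos x \<gamma>M that by simp
  have "((\<lambda>t. \<Sum>j\<in>{1..n}. c j * exp (?f j t)) has_real_derivative
      (\<Sum>j\<in>{1..n}. c j * (exp (?f j 0) * ?d j))) (at 0)"
    by (intro DERIV_sum DERIV_cmult DERIV_chain2[OF DERIV_exp] log_along_curve[OF X _ \<gamma>])
      (use x in auto)
  moreover have "(\<Sum>j\<in>{1..n}. c j * exp (?f j t)) = 0" for t
  proof -
    have "(\<Sum>j\<in>{1..n}. c j * exp (?f j t)) = exp (\<eta> (\<gamma> t)) * (\<Sum>j\<in>{1..n}. c j * \<kappa> (\<gamma> t) (x j))"
      unfolding sum_distrib_left by (intro sum.cong refl) (simp only: exp mult_ac)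
    then show ?thesis using null[OF \<gamma>M] by simp
  qed
  ultimately have "((\<lambda>t. 0) has_real_derivative (\<Sum>j\<in>{1..n}. c j * (exp (?f j 0) * ?d j))) (at 0)"
    by simp
  then have "(\<Sum>j\<in>{1..n}. c j * (exp (?f j 0) * ?d j)) = 0"
    by (rule DERIV_unique) (rule DERIV_const)
  moreover have "c j * (exp (?f j 0) * ?d j)
      = exp (\<eta> X) * sqrt 2 * (c j * \<kappa> X (x j) * (skew_part (H X (x j) ** transpose X) $ \<alpha> $ \<beta>))"
    if "j \<in> {1..n}" for j
    using exp[OF that, of 0] unfolding \<gamma>0 inner_matrix_mult_right inner_skew_unit
    by (simp only: mult_ac)
  then have "(\<Sum>j\<in>{1..n}. c j * (exp (?f j 0) * ?d j)) = exp (\<eta> X) * sqrt 2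
      * (\<Sum>j\<in>{1..n}. c j * \<kappa> X (x j) * (skew_part (H X (x j) ** transpose X) $ \<alpha> $ \<beta>))"
    unfolding sum_distrib_left by (intro sum.cong refl)
  ultimately have "exp (\<eta> X) * sqrt 2
      * (\<Sum>j\<in>{1..n}. c j * \<kappa> X (x j) * (skew_part (H X (x j) ** transpose X) $ \<alpha> $ \<beta>)) = 0"
    by (simp only:)
  then show ?thesis by simp
qed

lemma v_average_b_vec_orthogonal_kernel:
  assumes x: "\<forall>i\<in>{1..n}. x i \<in> stiefel" and "n \<noteq> 0"
    and null: "v_average n x q (Q_mat G \<kappa>) *v v = 0"
  shows "v_average n x q (b_vec G H \<kappa>) \<bullet> v = 0"
proof -
  let ?a = "skew_combination G v"
  let ?c = "\<lambda>\<alpha> \<beta> j. q (x j) * ?a (x j) $ \<alpha> $ \<beta>"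
  let ?S = "\<lambda>\<alpha> \<beta>. \<Sum>i\<in>{1..n}. \<Sum>j\<in>{1..n}. ?c \<alpha> \<beta> i * ?c \<alpha> \<beta> j * \<kappa> (x i) (x j)"
  have nonneg: "0 \<le> ?S \<alpha> \<beta>" for \<alpha> \<beta>
    by (rule kernel_sum_nonneg[OF kernel x])
  have "(\<Sum>\<alpha>\<in>UNIV. \<Sum>\<beta>\<in>UNIV. ?S \<alpha> \<beta>) = 0"
    using v_average_Q_mat_quadratic_form[of v n x q G \<kappa>] null \<open>n \<noteq> 0\<close> by simp
  with nonneg have "?S \<alpha> \<beta> = 0" for \<alpha> \<beta>
    by (rule double_sum_nonneg_eq_0)
  then have comb: "(\<Sum>j\<in>{1..n}. ?c \<alpha> \<beta> j * \<kappa> Z (x j)) = 0" if "Z \<in> stiefel" for Z \<alpha> \<beta>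
    by (rule kernel_null_combination[OF kernel x that])
  \<comment> \<open>The sum over the second argument already vanishes for each fixed first argument,
    entry by entry of the skew part.\<close>
  have "(\<Sum>j\<in>{1..n}. q (x j) * (b_vec G H \<kappa> X (x j) \<bullet> v)) = 0" if X: "X \<in> stiefel" for X
  proof -
    let ?B = "\<lambda>j. skew_part (H X (x j) ** transpose X)"
    have "(\<Sum>j\<in>{1..n}. q (x j) * (b_vec G H \<kappa> X (x j) \<bullet> v))
        = (\<Sum>j\<in>{1..n}. \<Sum>\<alpha>\<in>UNIV. \<Sum>\<beta>\<in>UNIV. ?c \<alpha> \<beta> j * \<kappa> X (x j) * ?B j $ \<alpha> $ \<beta>)"
      unfolding b_vec_inner by (simp add: inner_vec_def sum_distrib_left mult_ac)
    also have "\<dots> = (\<Sum>\<alpha>\<in>UNIV. \<Sum>j\<in>{1..n}. \<Sum>\<beta>\<in>UNIV. ?c \<alpha> \<beta> j * \<kappa> X (x j) * ?B j $ \<alpha> $ \<beta>)"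
      by (rule sum.swap)
    also have "\<dots> = (\<Sum>\<alpha>\<in>UNIV. \<Sum>\<beta>\<in>UNIV. \<Sum>j\<in>{1..n}. ?c \<alpha> \<beta> j * \<kappa> X (x j) * ?B j $ \<alpha> $ \<beta>)"
      by (intro sum.cong refl sum.swap)
    also have "\<dots> = 0"
      by (intro sum.neutral ballI null_combination_derivative[OF X x] comb)
    finally show ?thesis .
  qed
  then have "(\<Sum>i\<in>{1..n}. q (x i) / (real n)\<^sup>2 * (\<Sum>j\<in>{1..n}. q (x j) * (b_vec G H \<kappa> (x i) (x j) \<bullet> v))) = 0"
    using x by (intro sum.neutral) simp
  then show ?thesis
    unfolding v_average_eq_pair_sum pair_sum_linear[OF linear_inner_left, symmetric]
    by (simp add: pair_sum_def sum_distrib_left mult_ac)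
qed

end

text \<open>The listed sets are never empty, whereas a U-statistic unbounded below has no minimiser;
  boundedness below is what makes \<open>bu\<close> orthogonal to the kernel of \<open>Qu\<close>.
  For the V-statistic the kernel argument gives both positive semi-definiteness and
  orthogonality.\<close>

theorem theorem5p3:
  fixes \<kappa> :: "('r::finite, 'N::{finite,linorder}) rmat \<Rightarrow> ('r, 'N) rmat \<Rightarrow> real"
    and \<zeta> :: "('r, 'N) rmat \<Rightarrow> real^'s"
    and \<eta> :: "('r, 'N) rmat \<Rightarrow> real"
    and p :: "real^'s \<Rightarrow> ('r, 'N) rmat \<Rightarrow> real"
    and G :: "'s \<Rightarrow> ('r, 'N) rmat \<Rightarrow> ('r, 'N) rmat"
    and H :: "('r, 'N) rmat \<Rightarrow> ('r, 'N) rmat \<Rightarrow> ('r, 'N) rmat"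
    and n :: nat
    and x :: "nat \<Rightarrow> ('r, 'N) rmat"
    and q :: "('r, 'N) rmat \<Rightarrow> real"
    and Qu Qv :: "real^'s^'s"
    and bu bv :: "real^'s"
  assumes "CARD('r) \<le> CARD('N)"
    and "is_kernel stiefel \<kappa>"
    and "\<forall>X\<in>stiefel. \<forall>Y\<in>stiefel. 0 < \<kappa> X Y"
    and "C11_on stiefel \<kappa>"
    and "C1_on stiefel \<zeta>"
    and "C1_on stiefel \<eta>"
    and "\<forall>\<theta>. \<exists>c>0. \<forall>X\<in>stiefel. p \<theta> X = c * exp (\<theta> \<bullet> \<zeta> X + \<eta> X)"
    and "\<forall>k. \<forall>X\<in>stiefel. is_euclidean_gradient stiefel (\<lambda>X'. \<zeta> X' $ k) X (G k X)"
    and "\<forall>X\<in>stiefel. \<forall>Y\<in>stiefel.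
           is_euclidean_gradient stiefel (\<lambda>X'. ln (exp (\<eta> X') * \<kappa> X' Y)) X (H X Y)"
    and "2 \<le> n"
    and "\<forall>i\<in>{1..n}. x i \<in> stiefel"
    and "\<forall>X\<in>stiefel. 0 \<le> q X"
    and "Qu = u_average n x q (Q_mat G \<kappa>)"
    and "bu = u_average n x q (b_vec G H \<kappa>)"
    and "Qv = v_average n x q (Q_mat G \<kappa>)"
    and "bv = v_average n x q (b_vec G H \<kappa>)"
    and "pos_semidef Qu"
  shows "(bdd_below (range (ksd_u n x q p \<kappa>)) \<longrightarrow>
            argmin_set (ksd_u n x q p \<kappa>)
              = {- (mp_inverse Qu *v bu) - (mat 1 - mp_inverse Qu ** Qu) *v y | y. True})
         \<and> argmin_set (ksd_v n x q p \<kappa>)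
              = {- (mp_inverse Qv *v bv) - (mat 1 - mp_inverse Qv ** Qv) *v y | y. True}"
proof -
  interpret exponential_family_stein \<kappa> \<zeta> \<eta> p G H
    using assms(2-9) by unfold_locales
  have x: "\<forall>i\<in>{1..n}. x i \<in> stiefel" by fact
  let ?wu = "\<lambda>i j. if i = j then 0 else q (x i) * q (x j) / (real n * (real n - 1))"
  let ?wv = "\<lambda>i j. q (x i) * q (x j) / (real n)\<^sup>2"
  have wu: "?wu i j = ?wu j i" and wv: "?wv i j = ?wv j i" for i j
    by (simp_all add: mult.commute)
  obtain cu where U: "\<And>\<theta>. ksd_u n x q p \<kappa> \<theta> = \<theta> \<bullet> (Qu *v \<theta>) + 2 * (bu \<bullet> \<theta>) + cu"
    unfolding ksd_u_def \<open>Qu = _\<close> \<open>bu = _\<close> u_average_eq_pair_sum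
    by (rule pair_sum_stein_kernel_quadratic[where W = ?wu, OF wu x]) blast
  obtain cv where V: "\<And>\<theta>. ksd_v n x q p \<kappa> \<theta> = \<theta> \<bullet> (Qv *v \<theta>) + 2 * (bv \<bullet> \<theta>) + cv"
    unfolding ksd_v_def \<open>Qv = _\<close> \<open>bv = _\<close> v_average_eq_pair_sum
    by (rule pair_sum_stein_kernel_quadratic[where W = ?wv, OF wv x]) blast
  show ?thesis
  proof (intro conjI impI)
    assume "bdd_below (range (ksd_u n x q p \<kappa>))"
    then have "bu \<bullet> v = 0" if "Qu *v v = 0" for v
      using U that by (rule bdd_below_quadratic_orthogonal_kernel)
    then show "argmin_set (ksd_u n x q p \<kappa>)
        = {- (mp_inverse Qu *v bu) - (mat 1 - mp_inverse Qu ** Qu) *v y | y. True}"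
      using U by (rule argmin_quadratic[OF \<open>pos_semidef Qu\<close>])
  next
    have "pos_semidef Qv"
      unfolding \<open>Qv = _\<close> by (rule pos_semidef_v_average_Q_mat[OF kernel x])
    moreover have "bv \<bullet> v = 0" if "Qv *v v = 0" for v
      using v_average_b_vec_orthogonal_kernel[OF x] that \<open>2 \<le> n\<close>
      unfolding \<open>Qv = _\<close> \<open>bv = _\<close> by simp
    ultimately show "argmin_set (ksd_v n x q p \<kappa>)
        = {- (mp_inverse Qv *v bv) - (mat 1 - mp_inverse Qv ** Qv) *v y | y. True}"
      using V by (rule argmin_quadratic)
  qed
qed

end
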